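(* Let $p$ be a prime, let $a \in \mathbb{Z}_p^\times$ with $a+1 \in \mathbb{Z}_p^\times$, let $b \in \mathbb{Z}_p$, and let $f(x) = x^p + ax + b$. Then $f$ is a permutation polynomial $\bmod\ p^n$ for all $n \ge 1$. Thus the sequence $(x_n)_{n \in \mathbb{N}}$ with $x_n = f(n)$ is a low-discrepancy sequence in $\mathbb{Z}_p$.
   Context: $\mathbb{N} = \{1,2,3,\ldots\}$. $\mathbb{Z}_p$ is the ring of $p$-adic integers, $\mathbb{Z}_p^\times$ its group of units, and $|\cdot|_p$ the $p$-adic absolute value, normalized by $|p|_p = p^{-1}$. For $z \in \mathbb{Z}_p$ and $k \in \mathbb{N}$ put $D_p(z,p^{-k}) = \{x \in \mathbb{Z}_p : |x-z|_p \le p^{-k}\}$. For a sequence $(x_n)_{n\in\mathbb{N}} \subset \mathbb{Z}_p$ and $N \in \mathbb{N}$, the $p$-adic discrepancy is $$D_N(x_n) := \sup_{z \in \mathbb{Z}_p,\, k \in \mathbb{N}} \left| \frac{\#\left(D_p(z,p^{-k}) \cap \{x_1,\ldots,x_N\}\right)}{N} - \frac{1}{p^k} \right|,$$ where the elements of the sequence are counted with multiplicity. The sequence is called a ($p$-adic) low-discrepancy sequence if $D_N(x_n) = \mathcal{O}\left(\frac{1}{N}\right)$ as $N \to \infty$. A polynomial $f \in \mathbb{Z}_p[x]$ is called a permutation polynomial $\bmod\ p^n$ if the map it induces on $\mathbb{Z}_p/p^n\mathbb{Z}_p \cong \mathbb{Z}/p^n\mathbb{Z}$ is a bijection. *)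

theory Defs
  imports
    Complex_Main
    "HOL-Library.Landau_Symbols"
    "HOL-Computational_Algebra.Primes"
    "HOL-Algebra.QuotRing"
    "HOL-Algebra.UnivPoly"
begin

text \<open>
  The ring of \<open>p\<close>-adic integers as the inverse limit of the rings of residues modulo \<open>p ^ n\<close>:
  an element is the sequence of its least non-negative residues modulo \<open>p ^ 0, p ^ 1, p ^ 2, \<dots>\<close>.
\<close>

definition padic_int :: "nat \<Rightarrow> (nat \<Rightarrow> int) ring" where
  "padic_int p = \<lparr>
     carrier = {x. \<forall>n. 0 \<le> x n \<and> x n < int p ^ n \<and> x (Suc n) mod int p ^ n = x n},
     mult = (\<lambda>x y n. (x n * y n) mod int p ^ n),
     one = (\<lambda>n. 1 mod int p ^ n),
     zero = (\<lambda>n. 0),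
     add = (\<lambda>x y n. (x n + y n) mod int p ^ n)\<rparr>"

lemma padic_int_cring:
  assumes "p > 0"
  shows "cring (padic_int p)"
proof -
  have pos: "int p ^ n > 0" for n using assms by simp
  have lift: "u mod int p ^ Suc n mod int p ^ n = u mod int p ^ n" for u n
    by (simp add: mod_mod_cancel)
  have red: "x n mod int p ^ n = x n" if "x \<in> carrier (padic_int p)" for x n
    using that by (simp add: padic_int_def)
  have coh: "x (Suc n) mod int p ^ n = x n" if "x \<in> carrier (padic_int p)" for x n
    using that by (simp add: padic_int_def)
  have memI: "x \<in> carrier (padic_int p)"
    if "\<And>n. x n = y n mod int p ^ n" "\<And>n. y (Suc n) mod int p ^ n = y n mod int p ^ n" for x y
    unfolding padic_int_def using that pos lift by simp
  have add: "(\<lambda>n. (x n + y n) mod int p ^ n) \<in> carrier (padic_int p)"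
    if "x \<in> carrier (padic_int p)" "y \<in> carrier (padic_int p)" for x y
    by (rule memI[where y = "\<lambda>n. x n + y n"], simp) (metis coh that mod_add_eq)
  have mult: "(\<lambda>n. (x n * y n) mod int p ^ n) \<in> carrier (padic_int p)"
    if "x \<in> carrier (padic_int p)" "y \<in> carrier (padic_int p)" for x y
    by (rule memI[where y = "\<lambda>n. x n * y n"], simp) (metis coh that mod_mult_eq)
  have uminus: "(\<lambda>n. (- x n) mod int p ^ n) \<in> carrier (padic_int p)"
    if "x \<in> carrier (padic_int p)" for x
    by (rule memI[where y = "\<lambda>n. - x n"], simp) (metis coh that mod_minus_eq)
  have one: "(\<lambda>n. 1 mod int p ^ n) \<in> carrier (padic_int p)"
    by (rule memI[where y = "\<lambda>n. 1"]) simp_all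
  have zero: "(\<lambda>n. 0) \<in> carrier (padic_int p)"
    by (rule memI[where y = "\<lambda>n. 0"]) simp_all
  note sel = padic_int_def[THEN arg_cong[where f = add]]
    padic_int_def[THEN arg_cong[where f = mult]]
    padic_int_def[THEN arg_cong[where f = one]]
    padic_int_def[THEN arg_cong[where f = zero]]
  show ?thesis
  proof (rule cringI)
    show "abelian_group (padic_int p)"
    proof (rule abelian_groupI)
      fix x assume x: "x \<in> carrier (padic_int p)"
      show "\<exists>y\<in>carrier (padic_int p). y \<oplus>\<^bsub>padic_int p\<^esub> x = \<zero>\<^bsub>padic_int p\<^esub>"
        by (rule bexI[OF _ uminus[OF x]]) (simp add: sel mod_simps)
    qed (auto simp: sel add zero red mod_simps algebra_simps)
    show "comm_monoid (padic_int p)"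
      by (rule comm_monoidI) (auto simp: sel mult one red mod_simps algebra_simps)
  qed (auto simp: sel mod_simps algebra_simps)
qed

definition padic_of_nat :: "nat \<Rightarrow> nat \<Rightarrow> (nat \<Rightarrow> int)" where
  "padic_of_nat p m = [m] \<cdot>\<^bsub>padic_int p\<^esub> \<one>\<^bsub>padic_int p\<^esub>"

definition padic_pow_ideal :: "nat \<Rightarrow> nat \<Rightarrow> (nat \<Rightarrow> int) set" where
  "padic_pow_ideal p n = PIdl\<^bsub>padic_int p\<^esub> (padic_of_nat p (p ^ n))"

text \<open>
  For nonzero \<open>x\<close> the exponent below is the \<open>p\<close>-adic valuation of \<open>x\<close>,
  i.e. the largest \<open>n\<close> such that \<open>p ^ n\<close> divides \<open>x\<close>.
\<close>

definition padic_abs :: "nat \<Rightarrow> (nat \<Rightarrow> int) \<Rightarrow> real" where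
  "padic_abs p x =
     (if x = \<zero>\<^bsub>padic_int p\<^esub> then 0 else 1 / real p ^ (GREATEST n. x \<in> padic_pow_ideal p n))"

definition padic_disc :: "nat \<Rightarrow> (nat \<Rightarrow> int) \<Rightarrow> nat \<Rightarrow> (nat \<Rightarrow> int) set" where
  "padic_disc p z k =
     {x \<in> carrier (padic_int p). padic_abs p (x \<ominus>\<^bsub>padic_int p\<^esub> z) \<le> 1 / real p ^ k}"

text \<open>
  Sequences are indexed by the positive integers, so \<open>x 0\<close> is irrelevant. Counting indices
  rather than values counts the elements with multiplicity. For \<open>N > 0\<close> the supremum is over
  a nonempty set of reals bounded by 1.
\<close>

definition padic_discrepancy :: "nat \<Rightarrow> (nat \<Rightarrow> nat \<Rightarrow> int) \<Rightarrow> nat \<Rightarrow> real" where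
  "padic_discrepancy p x N =
     (SUP (z, k) \<in> carrier (padic_int p) \<times> {1..}.
        \<bar>real (card {n \<in> {1..N}. x n \<in> padic_disc p z k}) / real N - 1 / real p ^ k\<bar>)"

definition padic_low_discrepancy :: "nat \<Rightarrow> (nat \<Rightarrow> nat \<Rightarrow> int) \<Rightarrow> bool" where
  "padic_low_discrepancy p x \<longleftrightarrow>
     (\<forall>n\<ge>1. x n \<in> carrier (padic_int p)) \<and>
     (\<lambda>N. padic_discrepancy p x N) \<in> O[at_top](\<lambda>N. 1 / real N)"

text \<open>
  The induced map on the quotient ring evaluates \<open>f\<close> at a residue class,
  with the coefficients of \<open>f\<close> reduced along the quotient map.
\<close>

definition padic_induced_map ::
  "nat \<Rightarrow> nat \<Rightarrow> (nat \<Rightarrow> nat \<Rightarrow> int) \<Rightarrow> (nat \<Rightarrow> int) set \<Rightarrow> (nat \<Rightarrow> int) set" where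
  "padic_induced_map p n f X =
     eval (padic_int p) (padic_int p Quot padic_pow_ideal p n)
       (\<lambda>c. padic_pow_ideal p n +>\<^bsub>padic_int p\<^esub> c) X f"

definition padic_permutation_poly :: "nat \<Rightarrow> nat \<Rightarrow> (nat \<Rightarrow> nat \<Rightarrow> int) \<Rightarrow> bool" where
  "padic_permutation_poly p n f \<longleftrightarrow>
     f \<in> carrier (UP (padic_int p)) \<and>
     bij_betw (padic_induced_map p n f)
       (carrier (padic_int p Quot padic_pow_ideal p n))
       (carrier (padic_int p Quot padic_pow_ideal p n))"

end

theory Submission
  imports Defs "HOL-Number_Theory.Residues"
begin

text \<open>
  The map \<open>F x = x ^ p + a x + b\<close> is an isometry of the \<open>p\<close>-adic integers, and both claims follow
  from that alone. Factoring gives \<open>F x - F y = (x - y) * (S + a)\<close> with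
  \<open>S = (\<Sum>i<p. y ^ (p - 1 - i) * x ^ i)\<close>, and \<open>S + a\<close> is always a unit. If \<open>x \<equiv> y\<close> modulo \<open>p\<close>, then
  \<open>S \<equiv> p x ^ (p - 1) \<equiv> 0\<close>, so \<open>S + a \<equiv> a\<close>. Otherwise Fermat's little theorem gives
  \<open>(x - y) * (S + a) \<equiv> (x - y) * (1 + a)\<close>, and \<open>x - y\<close> cancels, so \<open>S + a \<equiv> 1 + a\<close>. This is where the
  two unit hypotheses enter (\<open>prime_power_dvd_trinomial_diff_iff\<close>, \<open>residue_isometry_trinomial\<close>).

  An isometry induces an injective map on each quotient modulo \<open>p ^ n\<close>, and an injective self-map of
  a finite set is a bijection (\<open>isometry_imp_permutation_poly\<close>).

  A disc of radius \<open>p ^ -k\<close> is a residue class modulo \<open>p ^ k\<close>. Since \<open>F\<close> permutes these classes,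
  the indices \<open>n\<close> with \<open>F n\<close> in a given disc form a single residue class modulo \<open>p ^ k\<close>. Among
  \<open>1, \<dots>, N\<close> that class has at least \<open>N div p ^ k\<close> and at most \<open>N div p ^ k + 1\<close> elements, so the
  discrepancy is at most \<open>1 / N\<close> (\<open>card_fibre_periodic_injective\<close>,
  \<open>isometry_imp_low_discrepancy\<close>).

  All computations with \<open>p\<close>-adic integers are carried out on their residues \<open>x n\<close> modulo \<open>p ^ n\<close>: the
  ideal generated by \<open>p ^ n\<close> turns out to be the set of \<open>x\<close> with \<open>x n = 0\<close>
  (\<open>padic_pow_ideal_eq\<close>), which translates cosets, absolute values and discs into conditions on
  residues.
\<close>

section \<open>The isometry property over the integers\<close>

text \<open>
  Fermat's little theorem, extended to all integers by reduction to the least non-negative residue.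
\<close>
lemma prime_dvd_power_minus_self:
  fixes p :: nat and x :: int
  assumes "prime p"
  shows "int p dvd x ^ p - x"
proof -
  define m where "m = nat (x mod int p)"
  have p: "p > 0" using assms prime_gt_0_nat by blast
  have m: "int m = x mod int p" using p by (simp add: m_def)
  have "[m ^ p = m] (mod p)"
  proof (cases "p dvd m")
    case True
    then show ?thesis using p by (metis cong_0_iff cong_sym cong_trans dvd_trans dvd_power)
  next
    case False
    then have "[m * m ^ (p - 1) = m * 1] (mod p)"
      using fermat_theorem[OF assms] cong_scalar_left by blast
    then show ?thesis using p by (simp flip: power_Suc)
  qed
  then have "[int m ^ p = int m] (mod int p)" by (metis cong_int_iff of_nat_power)
  then have "[x ^ p = x] (mod int p)" by (simp add: m cong_def power_mod)
  then show ?thesis by (simp add: cong_iff_dvd_diff)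
qed

text \<open>
  The integer form of the isometry property: the cofactor of \<open>x - y\<close> in the difference of the two
  values is prime to \<open>p\<close>, whether or not \<open>p\<close> divides \<open>x - y\<close>.
\<close>
lemma prime_power_dvd_trinomial_diff_iff:
  fixes p n :: nat and a b x y :: int
  assumes "prime p" "\<not> int p dvd a" "\<not> int p dvd a + 1"
  shows "int p ^ n dvd (x ^ p + a * x + b) - (y ^ p + a * y + b) \<longleftrightarrow> int p ^ n dvd x - y"
proof -
  define S where "S = (\<Sum>i<p. y ^ (p - Suc i) * x ^ i)"
  have S: "x ^ p - y ^ p = (x - y) * S" unfolding S_def by (rule power_diff_sumr2)
  have ip: "prime (int p)" using assms(1) by simp
  have u: "\<not> int p dvd S + a"
  proof (cases "int p dvd x - y")
    case True
    \<comment> \<open>All \<open>p\<close> summands of \<open>S\<close> are congruent to \<open>x ^ (p - 1)\<close>, so \<open>S\<close> vanishes modulo \<open>p\<close>.\<close>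
    then have xy: "[y = x] (mod int p)" by (simp add: cong_iff_dvd_diff dvd_diff_commute)
    have "[S = (\<Sum>i<p. x ^ (p - 1))] (mod int p)" unfolding S_def
    proof (rule cong_sum)
      fix i assume "i \<in> {..<p}"
      then have "x ^ (p - Suc i) * x ^ i = x ^ (p - 1)" by (simp flip: power_add)
      then show "[y ^ (p - Suc i) * x ^ i = x ^ (p - 1)] (mod int p)"
        using cong_mult[OF cong_pow[OF xy] cong_refl] by metis
    qed
    then have "int p dvd S" by (simp add: cong_def dvd_eq_mod_eq_0)
    then show ?thesis using assms(2) by (simp add: dvd_add_right_iff)
  next
    case False
    \<comment> \<open>By Fermat, \<open>(x - y) * (S + a)\<close> is congruent to \<open>(x - y) * (a + 1)\<close> modulo \<open>p\<close>.\<close>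
    have "(x - y) * (S + a) = (x ^ p - x) - (y ^ p - y) + (x - y) * (a + 1)"
      using S by (simp add: algebra_simps)
    moreover have "int p dvd (x ^ p - x) - (y ^ p - y)"
      by (intro dvd_diff prime_dvd_power_minus_self assms(1))
    moreover have "\<not> int p dvd (x - y) * (a + 1)"
      using False assms(3) ip prime_dvd_multD by blast
    ultimately have "\<not> int p dvd (x - y) * (S + a)" by (simp add: dvd_add_right_iff)
    then show ?thesis by auto
  qed
  have "(x ^ p + a * x + b) - (y ^ p + a * y + b) = (x - y) * (S + a)"
    using S by (simp add: algebra_simps)
  moreover have "coprime (int p ^ n) (S + a)"
    using prime_imp_coprime[OF ip u] by simp
  ultimately show ?thesis by (simp add: coprime_dvd_mult_left_iff)
qed

section \<open>Counting terms in a residue class\<close>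

text \<open>
  Choosing the representative \<open>r\<close> in \<open>{1..M}\<close> makes \<open>r\<close> the least positive element of its class, so
  the class meets \<open>{1..N}\<close> in exactly \<open>(N + M - r) div M\<close> elements.
\<close>
lemma card_residue_class_bounds:
  fixes N M r :: nat
  assumes "r \<in> {1..M}"
  shows "N div M \<le> card {n \<in> {1..N}. [n = r] (mod M)}"
    and "card {n \<in> {1..N}. [n = r] (mod M)} \<le> N div M + 1"
proof -
  have M: "M > 0" and r: "1 \<le> r" "r \<le> M" using assms by auto
  have "{n \<in> {1..N}. [n = r] (mod M)} = (\<lambda>q. r + q * M) ` {..<(N + M - r) div M}"
  proof (intro equalityI subsetI)
    fix n assume "n \<in> {n \<in> {1..N}. [n = r] (mod M)}"
    then have n: "1 \<le> n" "n \<le> N" "[n = r] (mod M)" by auto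
    have "n \<ge> r"
    proof (rule ccontr)
      assume "\<not> n \<ge> r"
      then have "n < M" using r by linarith
      then show False using n \<open>\<not> n \<ge> r\<close> r
        by (metis cong_def le_neq_implies_less linorder_not_less mod_less mod_self
            not_one_le_zero order_refl)
    qed
    then obtain q where q: "n = r + q * M"
      using n(3) cong_le_nat[of r n M] cong_sym by (metis add.commute)
    then have "Suc q * M \<le> N + M - r" using n r by simp
    then have "q < (N + M - r) div M"
      using M by (metis Suc_le_eq less_eq_div_iff_mult_less_eq)
    then show "n \<in> (\<lambda>q. r + q * M) ` {..<(N + M - r) div M}" using q by blast
  next
    fix n assume "n \<in> (\<lambda>q. r + q * M) ` {..<(N + M - r) div M}"
    then obtain q where q: "n = r + q * M" "q < (N + M - r) div M" by blast
    then have "Suc q * M \<le> N + M - r"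
      using M by (metis Suc_le_eq less_eq_div_iff_mult_less_eq)
    then have "n \<le> N" using q r by simp
    then show "n \<in> {n \<in> {1..N}. [n = r] (mod M)}" using q r by (simp add: cong_def)
  qed
  moreover have "inj_on (\<lambda>q. r + q * M) {..<(N + M - r) div M}"
    using M by (auto intro: inj_onI)
  ultimately have c: "card {n \<in> {1..N}. [n = r] (mod M)} = (N + M - r) div M"
    by (simp add: card_image)
  show "N div M \<le> card {n \<in> {1..N}. [n = r] (mod M)}"
    unfolding c using r by (intro div_le_mono) linarith
  have "(N + M - r) div M \<le> (N + M) div M" by (intro div_le_mono) linarith
  then show "card {n \<in> {1..N}. [n = r] (mod M)} \<le> N div M + 1"
    unfolding c using M by simp
qed

text \<open>
  A sequence of residues that depends only on the index modulo \<open>M\<close>, and injectively so, hits every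
  residue by counting. Each of its fibres is therefore a residue class of indices, whose size
  differs from \<open>N / M\<close> by at most one.
\<close>
lemma card_fibre_periodic_injective:
  fixes g :: "nat \<Rightarrow> int" and c :: int and M N :: nat
  assumes "M > 0" "N > 0"
    and range: "\<And>n. g n \<in> {0..<int M}"
    and inj: "\<And>m n. g m = g n \<longleftrightarrow> [m = n] (mod M)"
    and c: "c \<in> {0..<int M}"
  shows "\<bar>real (card {n \<in> {1..N}. g n = c}) / real N - 1 / real M\<bar> \<le> 1 / real N"
proof -
  have "inj_on g {1..M}"
  proof (rule inj_onI)
    fix m n assume mn: "m \<in> {1..M}" "n \<in> {1..M}" "g m = g n"
    then have "[m - 1 = n - 1] (mod M)"
      using inj[of m n] by (metis atLeastAtMost_iff cong_add_rcancel_nat le_add_diff_inverse2)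
    moreover have "m - 1 < M" "n - 1 < M" using mn assms(1) by auto
    ultimately have "m - 1 = n - 1" by (simp add: cong_def)
    then show "m = n" using mn by auto
  qed
  then have "card (g ` {1..M}) = card {0..<int M}" by (simp add: card_image)
  then have "g ` {1..M} = {0..<int M}" using range by (intro card_subset_eq) auto
  then obtain r where r: "r \<in> {1..M}" "g r = c" using c by (metis imageE)
  define C where "C = card {n \<in> {1..N}. g n = c}"
  have "{n \<in> {1..N}. g n = c} = {n \<in> {1..N}. [n = r] (mod M)}" using inj r(2) by auto
  then have "N div M \<le> C" "C \<le> N div M + 1"
    using card_residue_class_bounds[OF r(1), of N] by (simp_all add: C_def)
  then have "real (N div M) \<le> real C" "real C \<le> real (N div M) + 1" by linarith+
  moreover have "real (N div M) \<le> real N / real M" 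
    by (rule of_nat_div_le_of_nat)
  moreover have "real N / real M \<le> real (N div M) + 1"
  proof -
    have "N \<le> (N div M + 1) * M"
      using dividend_less_div_times[OF assms(1), of N] by (simp add: mult.commute)
    then have "real N \<le> real ((N div M + 1) * M)" by (simp only: of_nat_le_iff)
    then show ?thesis using assms(1) by (simp add: pos_divide_le_eq algebra_simps)
  qed
  ultimately have "\<bar>real C - real N / real M\<bar> \<le> 1" by linarith
  moreover have "real C / real N - 1 / real M = (real C - real N / real M) / real N"
    using assms by (simp add: field_simps)
  ultimately show ?thesis using assms(2) by (simp add: C_def divide_right_mono)
qed

section \<open>Residues of \<open>p\<close>-adic integers\<close>

lemma padic_residue_range:
  "x \<in> carrier (padic_int p) \<Longrightarrow> 0 \<le> x n" "x \<in> carrier (padic_int p) \<Longrightarrow> x n < int p ^ n"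
  by (simp_all add: padic_int_def)

lemma padic_residue_mod:
  assumes "x \<in> carrier (padic_int p)" "n \<le> m"
  shows "x m mod int p ^ n = x n"
  using assms(2)
proof (induction m rule: dec_induct)
  case base
  then show ?case using padic_residue_range[OF assms(1)] by simp
next
  case (step m)
  have "x (Suc m) mod int p ^ n = x (Suc m) mod int p ^ m mod int p ^ n"
    using step by (simp add: mod_mod_cancel le_imp_power_dvd)
  also have "\<dots> = x n" using step assms(1) by (simp add: padic_int_def)
  finally show ?case .
qed

lemma padic_residue_eq_0_iff:
  "x \<in> carrier (padic_int p) \<Longrightarrow> x n = 0 \<longleftrightarrow> int p ^ n dvd x n"
  using padic_residue_mod[of x p n n] by (auto simp: dvd_eq_mod_eq_0)

lemma padic_residue_add: "(x \<oplus>\<^bsub>padic_int p\<^esub> y) n = (x n + y n) mod int p ^ n"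
  and padic_residue_mult: "(x \<otimes>\<^bsub>padic_int p\<^esub> y) n = (x n * y n) mod int p ^ n"
  and padic_residue_one: "\<one>\<^bsub>padic_int p\<^esub> n = 1 mod int p ^ n"
  and padic_residue_zero: "\<zero>\<^bsub>padic_int p\<^esub> n = 0"
  by (simp_all add: padic_int_def)

lemma padic_residue_pow:
  "(x [^]\<^bsub>padic_int p\<^esub> m) n = (x n ^ m) mod int p ^ n" for m :: nat
proof (induction m)
  case 0
  show ?case by (simp add: nat_pow_def padic_residue_one)
next
  case (Suc m)
  have "(x [^]\<^bsub>padic_int p\<^esub> Suc m) n
      = ((x [^]\<^bsub>padic_int p\<^esub> m) n * x n) mod int p ^ n"
    by (simp add: nat_pow_def padic_residue_mult)
  then show ?case unfolding Suc by (simp add: mod_mult_left_eq power_commutes)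
qed

lemma padic_of_nat_closed:
  assumes "p > 0"
  shows "padic_of_nat p m \<in> carrier (padic_int p)"
proof -
  interpret cring "padic_int p" by (rule padic_int_cring[OF assms])
  show ?thesis by (simp add: padic_of_nat_def)
qed

lemma padic_residue_of_nat: "padic_of_nat p m n = int m mod int p ^ n"
proof (induction m)
  case 0
  show ?case by (simp add: padic_of_nat_def add_pow_def nat_pow_def padic_residue_zero)
next
  case (Suc m)
  have "padic_of_nat p (Suc m) n = (padic_of_nat p m n + \<one>\<^bsub>padic_int p\<^esub> n) mod int p ^ n"
    by (simp add: padic_of_nat_def add_pow_def nat_pow_def padic_residue_add)
  then show ?case unfolding Suc padic_residue_one by (simp add: mod_add_eq add.commute)
qed

text \<open>
  The residues of a difference are recovered from the equation \<open>(x - y) + y = x\<close>, since the additive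
  inverse is only characterised by the ring structure.
\<close>
lemma padic_residue_diff_eq_0_iff:
  assumes "p > 0" "x \<in> carrier (padic_int p)" "y \<in> carrier (padic_int p)"
  shows "(x \<ominus>\<^bsub>padic_int p\<^esub> y) n = 0 \<longleftrightarrow> x n = y n"
proof -
  interpret cring "padic_int p" by (rule padic_int_cring[OF assms(1)])
  define w where "w = x \<ominus>\<^bsub>padic_int p\<^esub> y"
  have w: "w \<in> carrier (padic_int p)" using assms by (simp add: w_def)
  have "w \<oplus>\<^bsub>padic_int p\<^esub> y = x" using assms by (simp add: w_def minus_eq a_assoc l_neg)
  then have x: "(w n + y n) mod int p ^ n = x n" by (metis padic_residue_add)
  have y: "y n mod int p ^ n = y n" using padic_residue_mod[OF assms(3)] by simp
  have "w n = 0 \<longleftrightarrow> x n = y n"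
  proof
    assume "x n = y n"
    then have "int p ^ n dvd w n" using x y
      by (metis add_diff_cancel_right' mod_eq_dvd_iff)
    then show "w n = 0" using w padic_residue_eq_0_iff by blast
  qed (use x y in simp)
  then show ?thesis by (simp add: w_def)
qed

text \<open>
  If the residue of \<open>x\<close> modulo \<open>p ^ n\<close> vanishes, every later residue is divisible by \<open>p ^ n\<close>. The
  quotient of \<open>x\<close> by \<open>p ^ n\<close> is then obtained by shifting the sequence of residues by \<open>n\<close> places and
  dividing each term; the shift compensates for the \<open>n\<close> digits of precision lost in the division.
\<close>
lemma padic_pow_ideal_eq:
  assumes "p > 0"
  shows "padic_pow_ideal p n = {x \<in> carrier (padic_int p). x n = 0}"
proof (intro equalityI subsetI)
  interpret cring "padic_int p" by (rule padic_int_cring[OF assms])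
  fix x assume "x \<in> padic_pow_ideal p n"
  then obtain y where "y \<in> carrier (padic_int p)" "x = y \<otimes>\<^bsub>padic_int p\<^esub> padic_of_nat p (p ^ n)"
    by (auto simp: padic_pow_ideal_def cgenideal_def)
  then show "x \<in> {x \<in> carrier (padic_int p). x n = 0}"
    using assms by (simp add: padic_of_nat_closed padic_residue_mult padic_residue_of_nat)
next
  fix x assume "x \<in> {x \<in> carrier (padic_int p). x n = 0}"
  then have x: "x \<in> carrier (padic_int p)" and xn: "x n = 0" by auto
  define y where "y = (\<lambda>m. x (m + n) div int p ^ n)"
  have pos: "int p ^ m > 0" for m using assms by simp
  have "y (Suc m) mod int p ^ m = y m" for m
  proof -
    have "x (Suc m + n) mod int p ^ (n + m) = x (n + m)" by (rule padic_residue_mod[OF x]) simp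
    then have "int p ^ n * (y (Suc m) mod int p ^ m) + x (Suc m + n) mod int p ^ n = x (n + m)"
      using zmod_zmult2_eq[of "int p ^ m" "x (Suc m + n)" "int p ^ n"]
      unfolding y_def power_add by simp
    moreover have "x (Suc m + n) mod int p ^ n = 0" using padic_residue_mod[OF x] xn by simp
    ultimately have "x (m + n) = int p ^ n * (y (Suc m) mod int p ^ m)" by (simp add: add.commute)
    then show ?thesis using assms by (simp add: y_def)
  qed
  moreover have "0 \<le> y m" for m
    using padic_residue_range[OF x] pos by (simp add: y_def pos_imp_zdiv_nonneg_iff)
  moreover have "y m < int p ^ m" for m
  proof -
    have "x (m + n) < int p ^ m * int p ^ n"
      using padic_residue_range(2)[OF x] by (metis power_add)
    moreover have "y m * int p ^ n \<le> x (m + n)"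
      using minus_mod_eq_div_mult[of "x (m + n)" "int p ^ n"] pos_mod_sign[OF pos[of n], of "x (m + n)"]
      unfolding y_def by linarith
    ultimately have "y m * int p ^ n < int p ^ m * int p ^ n" by linarith
    then show ?thesis using pos by simp
  qed
  ultimately have y: "y \<in> carrier (padic_int p)" by (simp add: padic_int_def)
  have "(y \<otimes>\<^bsub>padic_int p\<^esub> padic_of_nat p (p ^ n)) m = x m" for m
  proof -
    have "x (m + n) mod int p ^ n = 0" using padic_residue_mod[OF x] xn by simp
    then have "y m * int p ^ n = x (m + n)" by (auto simp: y_def)
    then show ?thesis using padic_residue_mod[OF x, of m "m + n"]
      by (simp add: padic_residue_mult padic_residue_of_nat mod_simps)
  qed
  then have "x = y \<otimes>\<^bsub>padic_int p\<^esub> padic_of_nat p (p ^ n)" by (simp add: fun_eq_iff)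
  then show "x \<in> padic_pow_ideal p n"
    using y by (auto simp: padic_pow_ideal_def cgenideal_def)
qed

lemma padic_pow_ideal_ideal:
  assumes "p > 0"
  shows "ideal (padic_pow_ideal p n) (padic_int p)"
proof -
  interpret cring "padic_int p" by (rule padic_int_cring[OF assms])
  show ?thesis unfolding padic_pow_ideal_def
    by (intro cgenideal_ideal padic_of_nat_closed assms)
qed

lemma padic_coset_eq_iff:
  assumes "p > 0" "x \<in> carrier (padic_int p)" "y \<in> carrier (padic_int p)"
  shows "padic_pow_ideal p n +>\<^bsub>padic_int p\<^esub> x = padic_pow_ideal p n +>\<^bsub>padic_int p\<^esub> y \<longleftrightarrow> x n = y n"
proof -
  interpret cring "padic_int p" by (rule padic_int_cring[OF assms(1)])
  have "padic_pow_ideal p n +>\<^bsub>padic_int p\<^esub> x = padic_pow_ideal p n +>\<^bsub>padic_int p\<^esub> y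
      \<longleftrightarrow> x \<ominus>\<^bsub>padic_int p\<^esub> y \<in> padic_pow_ideal p n"
    by (rule quotient_eq_iff_same_a_r_cos[OF padic_pow_ideal_ideal[OF assms(1)] assms(2,3),
          symmetric])
  also have "\<dots> \<longleftrightarrow> (x \<ominus>\<^bsub>padic_int p\<^esub> y) n = 0"
    using assms by (simp add: padic_pow_ideal_eq)
  also have "\<dots> \<longleftrightarrow> x n = y n" by (rule padic_residue_diff_eq_0_iff[OF assms])
  finally show ?thesis .
qed

text \<open>
  The indices \<open>i\<close> with \<open>x i = 0\<close> form an initial segment of the naturals, bounded when \<open>x\<close> is
  nonzero, and the valuation of \<open>x\<close> is its last element. The absolute value of zero is treated
  separately because that segment is then unbounded.
\<close>
lemma padic_abs_le_iff:
  assumes "p > 1" "x \<in> carrier (padic_int p)"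
  shows "padic_abs p x \<le> 1 / real p ^ k \<longleftrightarrow> x k = 0"
proof (cases "x = \<zero>\<^bsub>padic_int p\<^esub>")
  case True
  then show ?thesis using assms by (simp add: padic_abs_def padic_residue_zero)
next
  case False
  then obtain m where m: "x m \<noteq> 0" by (auto simp: fun_eq_iff padic_residue_zero)
  have down: "x i = 0" if "x j = 0" "i \<le> j" for i j
    using padic_residue_mod[OF assms(2) that(2)] that(1) by simp
  have bound: "i \<le> m" if "x i = 0" for i
    using down[OF that, of m] m by (meson nle_le)
  define G where "G = (GREATEST i. x i = 0)"
  have "x 0 = 0" using padic_residue_range[OF assms(2), of 0] by simp
  then have "x G = 0" unfolding G_def by (rule GreatestI_nat) (rule bound)
  moreover have "i \<le> G" if "x i = 0" for i
    unfolding G_def using that by (rule Greatest_le_nat) (rule bound)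
  ultimately have "x k = 0 \<longleftrightarrow> k \<le> G" using down by blast
  moreover have "padic_abs p x = 1 / real p ^ G"
    using False assms by (simp add: padic_abs_def padic_pow_ideal_eq G_def)
  moreover have "1 / real p ^ G \<le> 1 / real p ^ k \<longleftrightarrow> k \<le> G"
    using assms(1) by (simp add: field_simps)
  ultimately show ?thesis by simp
qed

lemma padic_disc_eq:
  assumes "p > 1" "z \<in> carrier (padic_int p)"
  shows "padic_disc p z k = {x \<in> carrier (padic_int p). x k = z k}"
proof -
  interpret cring "padic_int p" by (rule padic_int_cring) (use assms in simp)
  have "padic_abs p (x \<ominus>\<^bsub>padic_int p\<^esub> z) \<le> 1 / real p ^ k \<longleftrightarrow> x k = z k"
    if "x \<in> carrier (padic_int p)" for x
    using that assms padic_abs_le_iff[OF assms(1), of "x \<ominus>\<^bsub>padic_int p\<^esub> z"]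
    by (simp add: padic_residue_diff_eq_0_iff)
  then show ?thesis by (auto simp: padic_disc_def)
qed

text \<open>
  Reducing the equation \<open>c * a = 1\<close> modulo \<open>p\<close> shows that no residue of \<open>a\<close> from level 1 onwards is
  divisible by \<open>p\<close>; at level 0 every residue is 0.
\<close>
lemma padic_unit_not_dvd:
  assumes "prime p" "a \<in> Units (padic_int p)" "n \<ge> 1"
  shows "\<not> int p dvd a n"
proof
  assume "int p dvd a n"
  obtain c where ac: "c \<otimes>\<^bsub>padic_int p\<^esub> a = \<one>\<^bsub>padic_int p\<^esub>"
    using assms(2) by (auto simp: Units_def)
  have "(c n * a n) mod int p ^ n = 1 mod int p ^ n"
    using arg_cong[OF ac, of "\<lambda>x. x n"] by (simp add: padic_residue_mult padic_residue_one)
  moreover have "int p dvd int p ^ n" using assms(3) by (simp add: dvd_power)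
  ultimately have "(c n * a n) mod int p = 1 mod int p" by (metis mod_mod_cancel)
  moreover have "(c n * a n) mod int p = 0" using \<open>int p dvd a n\<close> by simp
  ultimately show False using prime_gt_1_nat[OF assms(1)] by simp
qed

section \<open>Permutation polynomials and discrepancy\<close>

text \<open>
  Isometries of the \<open>p\<close>-adic integers: two elements are at distance at most \<open>p ^ -n\<close> exactly if their
  residues modulo \<open>p ^ n\<close> agree, so preserving distances means preserving and reflecting these
  agreements for every \<open>n\<close>.
\<close>
definition residue_isometry :: "nat \<Rightarrow> ((nat \<Rightarrow> int) \<Rightarrow> (nat \<Rightarrow> int)) \<Rightarrow> bool" where
  "residue_isometry p F \<longleftrightarrow>
     (\<forall>x \<in> carrier (padic_int p). F x \<in> carrier (padic_int p)) \<and>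
     (\<forall>x \<in> carrier (padic_int p). \<forall>y \<in> carrier (padic_int p). \<forall>n. F x n = F y n \<longleftrightarrow> x n = y n)"

lemma carrier_padic_quotient:
  "carrier (padic_int p Quot padic_pow_ideal p n)
    = (\<lambda>x. padic_pow_ideal p n +>\<^bsub>padic_int p\<^esub> x) ` carrier (padic_int p)"
  by (auto simp: FactRing_def A_RCOSETS_def RCOSETS_def a_r_coset_def)

text \<open>
  A coset is determined by the residue modulo \<open>p ^ n\<close> of any of its members, and there are only
  finitely many residues.
\<close>
lemma finite_padic_quotient:
  assumes "p > 0"
  shows "finite (carrier (padic_int p Quot padic_pow_ideal p n))"
proof -
  let ?C = "carrier (padic_int p)" and ?h = "\<lambda>x. padic_pow_ideal p n +>\<^bsub>padic_int p\<^esub> x"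
  have "carrier (padic_int p Quot padic_pow_ideal p n) = ?h ` ?C"
    by (rule carrier_padic_quotient)
  also have "\<dots> \<subseteq> (\<lambda>v. ?h (SOME x. x \<in> ?C \<and> x n = v)) ` {0..<int p ^ n}"
  proof (rule image_subsetI)
    fix x assume x: "x \<in> ?C"
    define y where "y = (SOME y. y \<in> ?C \<and> y n = x n)"
    have "y \<in> ?C \<and> y n = x n" unfolding y_def by (rule someI[of _ x]) (use x in simp)
    then have "?h x = ?h y" using padic_coset_eq_iff[OF assms x] by simp
    then show "?h x \<in> (\<lambda>v. ?h (SOME x. x \<in> ?C \<and> x n = v)) ` {0..<int p ^ n}"
      using padic_residue_range[OF x, of n] by (auto simp: y_def)
  qed
  finally show ?thesis by (rule finite_subset) simp
qed

text \<open>
  The coset map is a ring homomorphism, so it can be pulled out of the sum that evaluates the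
  polynomial with reduced coefficients.
\<close>
lemma padic_induced_map_coset:
  assumes "p > 0" "f \<in> carrier (UP (padic_int p))" "x \<in> carrier (padic_int p)"
  shows "padic_induced_map p n f (padic_pow_ideal p n +>\<^bsub>padic_int p\<^esub> x)
    = padic_pow_ideal p n +>\<^bsub>padic_int p\<^esub> eval (padic_int p) (padic_int p) id x f"
proof -
  define R where "R = padic_int p"
  define I where "I = padic_pow_ideal p n"
  define h where "h = (+>\<^bsub>R\<^esub>) I"
  have R: "cring R" using padic_int_cring[OF assms(1)] by (simp add: R_def)
  interpret I: ideal I R using padic_pow_ideal_ideal[OF assms(1)] by (simp add: I_def R_def)
  interpret h: ring_hom_cring R "R Quot I" h
    unfolding h_def by (rule I.rcos_ring_hom_cring[OF R])
  interpret UP: UP_cring R "UP R" by unfold_locales simp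
  have f: "f \<in> carrier (UP R)" and x: "x \<in> carrier R" using assms by (simp_all add: R_def)
  have c: "coeff (UP R) f i \<in> carrier R" for i using f by simp
  have "eval R (R Quot I) h (h x) f
      = (\<Oplus>\<^bsub>R Quot I\<^esub>i\<in>{..deg R f}. h (coeff (UP R) f i) \<otimes>\<^bsub>R Quot I\<^esub> h x [^]\<^bsub>R Quot I\<^esub> i)"
    using f by (rule UP.eval_on_carrier)
  also have "\<dots> = h (\<Oplus>\<^bsub>R\<^esub>i\<in>{..deg R f}. coeff (UP R) f i \<otimes>\<^bsub>R\<^esub> x [^]\<^bsub>R\<^esub> i)"
    using c x by (subst h.hom_finsum) (auto simp: o_def intro!: h.S.finsum_cong')
  also have "(\<Oplus>\<^bsub>R\<^esub>i\<in>{..deg R f}. coeff (UP R) f i \<otimes>\<^bsub>R\<^esub> x [^]\<^bsub>R\<^esub> i) = eval R R id x f"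
    using f by (simp add: UP.eval_on_carrier)
  finally show ?thesis
    by (simp add: padic_induced_map_def h_def R_def I_def)
qed

text \<open>
  Reflecting agreement of residues modulo \<open>p ^ n\<close> makes the induced map injective on the finite
  quotient; injectivity there already yields surjectivity.
\<close>
lemma isometry_imp_permutation_poly:
  assumes "p > 0" and f: "f \<in> carrier (UP (padic_int p))"
    and iso: "residue_isometry p (\<lambda>x. eval (padic_int p) (padic_int p) id x f)"
  shows "padic_permutation_poly p n f"
proof -
  let ?C = "carrier (padic_int p)" and ?h = "\<lambda>x. padic_pow_ideal p n +>\<^bsub>padic_int p\<^esub> x"
  let ?Q = "carrier (padic_int p Quot padic_pow_ideal p n)"
  have Q: "?Q = ?h ` ?C" by (rule carrier_padic_quotient)
  have "inj_on (padic_induced_map p n f) ?Q"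
    unfolding Q using iso assms(1)
    by (auto simp: inj_on_def padic_induced_map_coset[OF assms(1) f] padic_coset_eq_iff
        residue_isometry_def)
  moreover have "padic_induced_map p n f ` ?Q \<subseteq> ?Q"
    unfolding Q using iso
    by (auto simp: padic_induced_map_coset[OF assms(1) f] residue_isometry_def)
  ultimately have "bij_betw (padic_induced_map p n f) ?Q ?Q"
    using endo_inj_surj[OF finite_padic_quotient[OF assms(1)]] by (auto simp: bij_betw_def)
  then show ?thesis using f by (simp add: padic_permutation_poly_def)
qed

text \<open>
  The level-\<open>k\<close> residue of \<open>F n\<close> is an injective function
  of \<open>n\<close> modulo \<open>p ^ k\<close>, and this bounds every local deviation by \<open>1 / N\<close>, uniformly in the centre and
  radius of the disc.
\<close>
lemma isometry_imp_low_discrepancy: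
  assumes p: "p > 1" and iso: "residue_isometry p F"
  shows "padic_low_discrepancy p (\<lambda>n. F (padic_of_nat p n))"
proof -
  let ?R = "padic_int p"
  have N: "padic_of_nat p n \<in> carrier ?R" for n using p by (simp add: padic_of_nat_closed)
  then have F: "F (padic_of_nat p n) \<in> carrier ?R" for n
    using iso by (simp add: residue_isometry_def)
  define d where "d = (\<lambda>N z k.
    \<bar>real (card {n \<in> {1..N}. F (padic_of_nat p n) \<in> padic_disc p z k}) / real N
      - 1 / real p ^ k\<bar>)"
  have d: "d N z k \<le> 1 / real N" if "N > 0" "z \<in> carrier ?R" for N z k
  proof -
    have "F (padic_of_nat p m) k = F (padic_of_nat p n) k \<longleftrightarrow> [m = n] (mod p ^ k)" for m n
    proof -
      have "F (padic_of_nat p m) k = F (padic_of_nat p n) k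
          \<longleftrightarrow> padic_of_nat p m k = padic_of_nat p n k"
        using iso N by (simp add: residue_isometry_def)
      also have "\<dots> \<longleftrightarrow> [int m = int n] (mod int (p ^ k))"
        by (simp add: padic_residue_of_nat cong_def)
      also have "\<dots> \<longleftrightarrow> [m = n] (mod p ^ k)" by (rule cong_int_iff)
      finally show ?thesis .
    qed
    moreover have "F (padic_of_nat p n) k \<in> {0..<int (p ^ k)}" for n
      using padic_residue_range[OF F, of n k] by simp
    moreover have "z k \<in> {0..<int (p ^ k)}" using padic_residue_range[OF that(2), of k] by simp
    moreover have "p ^ k > 0" using p by simp
    ultimately have "\<bar>real (card {n \<in> {1..N}. F (padic_of_nat p n) k = z k}) / real N
        - 1 / real (p ^ k)\<bar> \<le> 1 / real N"
      using that(1) by (intro card_fibre_periodic_injective)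
    then show ?thesis using p that F by (simp add: d_def padic_disc_eq)
  qed
  have ne: "carrier ?R \<times> {1::nat..} \<noteq> {}" using N by auto
  have D: "padic_discrepancy p (\<lambda>n. F (padic_of_nat p n)) N
    = (SUP (z, k) \<in> carrier ?R \<times> {1..}. d N z k)" for N
    by (simp add: padic_discrepancy_def d_def)
  have "norm (padic_discrepancy p (\<lambda>n. F (padic_of_nat p n)) N) \<le> 1 * norm (1 / real N)"
    if "N > 0" for N
  proof -
    have "(SUP (z, k) \<in> carrier ?R \<times> {1..}. d N z k) \<le> 1 / real N"
      using ne d[OF that] by (intro cSUP_least) auto
    \<comment> \<open>The Landau bound concerns the absolute value, so the supremum must also be non-negative.\<close>
    moreover have "0 \<le> (SUP (z, k) \<in> carrier ?R \<times> {1..}. d N z k)"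
    proof -
      have "bdd_above ((\<lambda>(z, k). d N z k) ` (carrier ?R \<times> {1..}))"
        using d[OF that] by (intro bdd_aboveI[of _ "1 / real N"]) auto
      then have "(\<lambda>(z, k). d N z k) (padic_of_nat p 0, 1)
          \<le> (SUP (z, k) \<in> carrier ?R \<times> {1..}. d N z k)"
        using N by (intro cSUP_upper) auto
      moreover have "0 \<le> d N (padic_of_nat p 0) 1" by (simp add: d_def)
      ultimately show ?thesis by simp
    qed
    ultimately show ?thesis by (simp add: D)
  qed
  then have "(\<lambda>N. padic_discrepancy p (\<lambda>n. F (padic_of_nat p n)) N) \<in> O(\<lambda>N. 1 / real N)"
    by (intro bigoI[where c = 1] eventually_at_top_linorderI[of 1]) auto
  then show ?thesis using F by (simp add: padic_low_discrepancy_def)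
qed

text \<open>
  At each level \<open>n \<ge> 1\<close> the integer statement applies with the residues of \<open>a\<close> and \<open>b\<close> as
  coefficients: a unit has residues prime to \<open>p\<close>, both for \<open>a\<close> and for \<open>a + 1\<close>. At level 0 all
  residues coincide.
\<close>
lemma residue_isometry_trinomial:
  assumes "prime p" and a: "a \<in> Units (padic_int p)"
    and a1: "a \<oplus>\<^bsub>padic_int p\<^esub> \<one>\<^bsub>padic_int p\<^esub> \<in> Units (padic_int p)"
    and b: "b \<in> carrier (padic_int p)"
  shows "residue_isometry p
    (\<lambda>x. x [^]\<^bsub>padic_int p\<^esub> p \<oplus>\<^bsub>padic_int p\<^esub> a \<otimes>\<^bsub>padic_int p\<^esub> x \<oplus>\<^bsub>padic_int p\<^esub> b)"
    (is "residue_isometry p ?F")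
proof -
  have p: "p > 0" using prime_gt_0_nat[OF assms(1)] .
  interpret cring "padic_int p" by (rule padic_int_cring[OF p])
  have a_closed: "a \<in> carrier (padic_int p)" using a by (rule Units_closed)
  have F: "?F x n = (x n ^ p + a n * x n + b n) mod int p ^ n" for x n
    by (simp add: padic_residue_add padic_residue_mult padic_residue_pow mod_simps)
  have "?F x n = ?F y n \<longleftrightarrow> x n = y n"
    if xy: "x \<in> carrier (padic_int p)" "y \<in> carrier (padic_int p)" for x y n
  proof (cases "n = 0")
    case True
    then show ?thesis
      using padic_residue_range[OF xy(1), of 0] padic_residue_range[OF xy(2), of 0] by (simp add: F)
  next
    case False
    then have n: "n \<ge> 1" by simp
    have "int p dvd int p ^ n" using n by (simp add: dvd_power)
    moreover have "\<not> int p dvd (a n + 1) mod int p ^ n"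
      using padic_unit_not_dvd[OF assms(1) a1 n]
      by (simp add: padic_residue_add padic_residue_one mod_simps)
    ultimately have "\<not> int p dvd a n + 1" by (simp add: dvd_mod_iff)
    then have "int p ^ n dvd (x n ^ p + a n * x n + b n) - (y n ^ p + a n * y n + b n)
        \<longleftrightarrow> int p ^ n dvd x n - y n"
      using padic_unit_not_dvd[OF assms(1) a n] assms(1)
      by (intro prime_power_dvd_trinomial_diff_iff)
    then have "?F x n = ?F y n \<longleftrightarrow> x n mod int p ^ n = y n mod int p ^ n"
      unfolding F by (simp only: mod_eq_dvd_iff)
    then show ?thesis using padic_residue_mod[OF xy(1)] padic_residue_mod[OF xy(2)] by simp
  qed
  then show ?thesis using a_closed b by (simp add: residue_isometry_def)
qed

theorem proposition1p3:
  fixes p :: nat and a b :: "nat \<Rightarrow> int" and f :: "nat \<Rightarrow> nat \<Rightarrow> int"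
  assumes "prime p"
    and "a \<in> Units (padic_int p)"
    and "a \<oplus>\<^bsub>padic_int p\<^esub> \<one>\<^bsub>padic_int p\<^esub> \<in> Units (padic_int p)"
    and "b \<in> carrier (padic_int p)"
    and "f = monom (UP (padic_int p)) \<one>\<^bsub>padic_int p\<^esub> p
           \<oplus>\<^bsub>UP (padic_int p)\<^esub> monom (UP (padic_int p)) a 1
           \<oplus>\<^bsub>UP (padic_int p)\<^esub> monom (UP (padic_int p)) b 0"
  shows "(\<forall>n\<ge>1. padic_permutation_poly p n f) \<and>
         padic_low_discrepancy p
           (\<lambda>n. eval (padic_int p) (padic_int p) id (padic_of_nat p n) f)"
proof -
  define R where "R = padic_int p"
  have p: "p > 0" "p > 1" using prime_gt_0_nat prime_gt_1_nat assms(1) by auto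
  interpret R: cring R unfolding R_def by (rule padic_int_cring[OF p(1)])
  interpret UP: UP_pre_univ_prop R R id "UP R" by unfold_locales simp_all
  have ab: "a \<in> carrier R" "b \<in> carrier R" using assms(2,4) by (auto simp: R_def Units_def)
  have f_eq: "f = monom (UP R) \<one>\<^bsub>R\<^esub> p \<oplus>\<^bsub>UP R\<^esub> monom (UP R) a 1 \<oplus>\<^bsub>UP R\<^esub> monom (UP R) b 0"
    using assms(5) by (simp add: R_def)
  have f: "f \<in> carrier (UP R)" using ab by (simp add: f_eq)
  have ev: "eval R R id x f = x [^]\<^bsub>R\<^esub> p \<oplus>\<^bsub>R\<^esub> a \<otimes>\<^bsub>R\<^esub> x \<oplus>\<^bsub>R\<^esub> b" if x: "x \<in> carrier R" for x
  proof -
    note hom = UP.eval_ring_hom[OF x]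
    show ?thesis using ab x
      by (simp add: f_eq ring_hom_add[OF hom] UP.eval_monom del: One_nat_def)
  qed
  have "residue_isometry p (\<lambda>x. eval (padic_int p) (padic_int p) id x f)"
    using residue_isometry_trinomial[OF assms(1-4)] ev
    by (simp add: residue_isometry_def R_def)
  then show ?thesis
    using isometry_imp_permutation_poly[OF p(1)] isometry_imp_low_discrepancy[OF p(2)] f
    by (simp add: R_def)
qed

end
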